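(* Let $q \geq 4$ be a composite positive integer (i.e. $q$ is not prime). Then the numbers $$\Big\{ \log\Big(2 \sin \frac{a\pi}{q}\Big) : 1 \leq a < \frac{q}{2} \Big\} \text{ and } \pi \quad (\text{if } q \text{ is odd}),$$ respectively $$\Big\{ \log\Big(2 \sin \frac{a\pi}{q}\Big) : 1 \leq a < \frac{q}{2} \Big\},\ \pi,\ \text{and } \log 2 \quad (\text{if } q \text{ is even}),$$ are linearly dependent over the field $\overline{\mathbb{Q}}$ of algebraic numbers. In fact, for every composite positive integer $q \geq 6$, the numbers $$\Big\{ \log \Big( 2 \sin \frac{a \pi}{q} \Big) : 1 \leq a < \frac{q}{2} \Big\}$$ are linearly dependent over $\mathbb{Q}$.
   Context: Here $\log$ denotes the principal branch of the logarithm (the numbers $2\sin(a\pi/q)$ for $1 \le a < q/2$ are positive reals, so these are real logarithms). Linear dependence of a finite family of numbers over a field $K$ means that there exist coefficients in $K$, not all zero, giving a vanishing linear combination. *)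

theory Defs
  imports "HOL-Analysis.Analysis" "HOL-Computational_Algebra.Computational_Algebra"
begin

text \<open>
  Finite families are represented as lists, so that repeated entries count as dependent.
\<close>

definition lin_dep_over :: "'a::field set \<Rightarrow> 'a list \<Rightarrow> bool" where
  "lin_dep_over K vs \<longleftrightarrow>
     (\<exists>cs. length cs = length vs \<and> set cs \<subseteq> K \<and> (\<exists>c\<in>set cs. c \<noteq> 0) \<and>
           (\<Sum>i<length vs. cs ! i * vs ! i) = 0)"

definition algebraic_numbers :: "complex set" where
  "algebraic_numbers = {z. algebraic z}"

definition log_sines :: "nat \<Rightarrow> complex list" where
  "log_sines q = map (\<lambda>a. Ln (complex_of_real (2 * sin (real a * pi / real q))))
                     (filter (\<lambda>a. 2 * a < q) [1..<q])"

end

theory Submission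
  imports Defs
begin

text \<open>
  For \<open>q \<ge> 6\<close> factor \<open>q = d m\<close> with \<open>d \<ge> 2\<close> and \<open>m \<ge> 3\<close>. Taking logarithms in the multiplication formula
  \<open>\<Prod>\<^sub>k\<^sub><\<^sub>d 2 sin (x + k\<pi>/d) = 2 sin (d x)\<close> at \<open>x = \<pi>/q\<close>, and folding each index
  \<open>j > q/2\<close> back to \<open>q - j\<close>, gives a relation with integer coefficients. The index \<open>1\<close> occurs
  on the left (for \<open>k = 0\<close>) but the right-hand side is the entry of index \<open>d \<noteq> 1\<close>, so the relation
  is nontrivial. Since \<open>m\<close> does not divide \<open>2\<close>, the index \<open>q/2\<close> never occurs.
  For \<open>q = 4\<close> the only logarithm is \<open>log (2 sin (\<pi>/4)) = (log 2)/2\<close>.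
\<close>

text \<open>The monic polynomial \<open>X^n - 1\<close> shares no root with its derivative
  \<open>n X^(n-1)\<close>, so it splits into distinct linear factors, one for each root of
  unity.\<close>

lemma prod_diff_roots_unity:
  fixes w :: complex
  assumes "n > 0"
  shows "(\<Prod>z | z ^ n = 1. w - z) = w ^ n - 1"
proof -
  define p :: "complex poly" where "p = monom 1 n + [:-1:]"
  have pz: "poly p z = z ^ n - 1" for z
    by (simp add: p_def poly_monom)
  have deg: "degree p = n"
    unfolding p_def using assms by (subst degree_add_eq_left) (simp_all add: degree_monom_eq)
  have lead: "lead_coeff p = 1"
    unfolding deg using assms by (simp add: p_def coeff_pCons split: nat.split)
  have "rsquarefree p"
    unfolding rsquarefree_roots
  proof (intro allI notI, elim conjE)
    fix a assume a: "poly p a = 0" "poly (pderiv p) a = 0"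
    from a(2) have "of_nat n * a ^ (n - 1) = 0"
      by (simp add: p_def pderiv_add pderiv_monom pderiv_pCons poly_monom)
    with a(1) assms show False
      by (auto simp: pz power_0_left split: if_splits)
  qed
  from complex_poly_decompose_rsquarefree[OF this]
  have "p = (\<Prod>z | z ^ n = 1. [:-z, 1:])"
    by (simp add: lead pz)
  then have "poly p w = (\<Prod>z | z ^ n = 1. poly [:-z, 1:] w)"
    by (simp add: poly_prod)
  then show ?thesis
    by (simp add: pz)
qed

text \<open>Chord length on the unit circle: pulling out the phase \<open>cis (a + b)\<close> leaves
  a number minus its conjugate.\<close>

lemma norm_cis_diff: "cmod (cis (2 * a) - cis (2 * b)) = 2 * \<bar>sin (a - b)\<bar>"
proof -
  have "cis (2 * a) - cis (2 * b) = cis (a + b) * (cis (a - b) - cis (b - a))"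
    by (simp add: algebra_simps cis_mult)
  also have "cis (a - b) - cis (b - a) = 2 * \<i> * complex_of_real (sin (a - b))"
    using sin_minus[of "a - b"] cos_minus[of "a - b"] by (simp add: complex_eq_iff)
  finally show ?thesis
    by (simp add: norm_mult)
qed

text \<open>Each factor is the distance from a point \<open>w\<close> of the unit circle to an
  \<open>n\<close>-th root of unity, so the product is the modulus of \<open>w^n - 1\<close>, again
  a chord. Absolute values avoid all sign conditions on \<open>x\<close>.\<close>

lemma prod_abs_sin:
  assumes "n > 0"
  shows "(\<Prod>k<n. 2 * \<bar>sin (x + real k * pi / real n)\<bar>) = 2 * \<bar>sin (real n * x)\<bar>"
proof -
  \<comment> \<open>The minus sign turns the difference of angles in the chord formula into
    \<open>x + k pi/n\<close>, up to sign.\<close>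
  let ?w = "cis (2 * (- x))"
  have "(\<Prod>k<n. 2 * \<bar>sin (x + real k * pi / real n)\<bar>)
      = (\<Prod>k<n. cmod (?w - cis (2 * pi * real k / real n)))"
  proof (intro prod.cong refl)
    fix k
    show "2 * \<bar>sin (x + real k * pi / real n)\<bar> = cmod (?w - cis (2 * pi * real k / real n))"
      using norm_cis_diff[of "- x" "real k * pi / real n"]
        sin_minus[of "x + real k * pi / real n"] by (simp add: mult_ac)
  qed
  also have "\<dots> = (\<Prod>z | z ^ n = 1. cmod (?w - z))"
    by (rule prod.reindex_bij_betw[OF Complex.bij_betw_roots_unity[OF assms]])
  also have "\<dots> = cmod (?w ^ n - 1)"
    by (simp add: prod_norm prod_diff_roots_unity[OF assms])
  also have "?w ^ n = cis (2 * (- (real n * x)))"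
    by (simp add: Complex.DeMoivre mult_ac)
  also have "cmod (\<dots> - 1) = 2 * \<bar>sin (real n * x)\<bar>"
    using norm_cis_diff[of "- (real n * x)" 0] by simp
  finally show ?thesis .
qed

text \<open>The coefficients are padded with zeros.\<close>

lemma lin_dep_over_append:
  assumes "lin_dep_over K vs" "0 \<in> K"
  shows "lin_dep_over K (vs @ ws)"
proof -
  from assms(1) obtain cs where cs: "length cs = length vs" "set cs \<subseteq> K"
    "\<exists>c\<in>set cs. c \<noteq> 0" "(\<Sum>i<length vs. cs ! i * vs ! i) = 0"
    unfolding lin_dep_over_def by blast
  let ?cs = "cs @ replicate (length ws) 0"
  have "(\<Sum>i<length (vs @ ws). ?cs ! i * (vs @ ws) ! i) = (\<Sum>i<length vs. ?cs ! i * (vs @ ws) ! i)"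
    using cs(1) by (intro sum.mono_neutral_right) (auto simp: nth_append)
  also have "\<dots> = (\<Sum>i<length vs. cs ! i * vs ! i)"
    using cs(1) by (intro sum.cong) (auto simp: nth_append)
  finally show ?thesis
    unfolding lin_dep_over_def using cs assms(2) by (intro exI[of _ ?cs]) auto
qed

lemma lin_dep_over_mono: "lin_dep_over K vs \<Longrightarrow> K \<subseteq> L \<Longrightarrow> lin_dep_over L vs"
  unfolding lin_dep_over_def by blast

lemma filter_half: "filter (\<lambda>a. 2 * a < q) [1..<q] = [1..<(q + 1) div 2]" for q :: nat
proof -
  define h where "h = (q + 1) div 2"
  have less_half: "2 * a < q \<longleftrightarrow> a < h" for a
    by (auto simp: h_def)
  \<comment> \<open>The upper bound \<open>n\<close> is separated from \<open>q\<close> so that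
    \<open>h\<close> stays fixed during the induction.\<close>
  have "filter (\<lambda>a. a < h) [1..<n] = [1..<min n h]" for n
  proof (induction n)
    case (Suc n)
    then show ?case
      by (cases "n < h") (auto simp: min_def)
  qed simp
  moreover have "min q h = h"
    by (simp add: h_def)
  ultimately show ?thesis
    unfolding less_half h_def[symmetric] by simp
qed

text \<open>This turns a relation between real logarithms, summed over a set of indices, into the
  list form. The sines are positive on the range of indices, so \<open>Ln\<close> agrees there with
  \<open>ln\<close>.\<close>

lemma lin_dep_over_log_sines:
  assumes K: "\<And>a. c a \<in> K"
    and a0: "1 \<le> a0" "2 * a0 < q" "c a0 \<noteq> 0"
    and sum: "(\<Sum>a | 1 \<le> a \<and> 2 * a < q. c a * complex_of_real (ln (2 * sin (real a * pi / real q)))) = 0"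
  shows "lin_dep_over K (log_sines q)"
proof -
  define h where "h = (q + 1) div 2"
  define f where "f a = Ln (complex_of_real (2 * sin (real a * pi / real q)))" for a
  have ls: "log_sines q = map f [1..<h]"
    unfolding log_sines_def filter_half f_def h_def by simp
  have f: "f a = complex_of_real (ln (2 * sin (real a * pi / real q)))" if "1 \<le> a" "2 * a < q" for a
  proof -
    have "0 < sin (real a * pi / real q)"
      using that by (intro sin_gt_zero) (auto simp: field_simps)
    then show ?thesis
      unfolding f_def by (subst Ln_of_real) auto
  qed
  have set_eq: "{a. 1 \<le> a \<and> 2 * a < q} = {1..<h}"
    by (auto simp: h_def)
  \<comment> \<open>List position \<open>i\<close> holds the entry of index
    \<open>i + 1\<close>.\<close>
  have "(\<Sum>i<h - 1. c (i + 1) * f (i + 1)) = (\<Sum>a = 1..<h. c a * f a)"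
    by (rule sum.reindex_bij_witness[of _ "\<lambda>a. a - 1" "\<lambda>i. i + 1"]) auto
  also have "\<dots> = 0"
    using sum unfolding set_eq[symmetric] by (subst (asm) sum.cong[OF refl]) (auto simp: f)
  finally have *: "(\<Sum>i<h - 1. c (i + 1) * f (i + 1)) = 0" .
  have "a0 \<in> {1..<h}"
    using a0 set_eq by blast
  show ?thesis
    unfolding lin_dep_over_def ls
  proof (intro exI[of _ "map c [1..<h]"] conjI)
    show "\<exists>x\<in>set (map c [1..<h]). x \<noteq> 0"
      using \<open>a0 \<in> {1..<h}\<close> a0(3) by auto
    show "(\<Sum>i<length (map f [1..<h]). map c [1..<h] ! i * map f [1..<h] ! i) = 0"
      using * by (simp add: add.commute)
  qed (use K in auto)
qed

text \<open>Two proper factors cannot both be 2 when \<open>q\<close> is at least 6, and a larger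
  one can be taken as \<open>m\<close>.\<close>

lemma composite_factorization:
  fixes q :: nat
  assumes "q \<ge> 6" "\<not> prime q"
  obtains d m where "q = d * m" "d \<ge> 2" "m \<ge> 3"
proof -
  from assms obtain a where a: "a dvd q" "a \<noteq> 1" "a \<noteq> q"
    by (auto simp: prime_nat_iff)
  then obtain b where b: "q = a * b" by auto
  have "a \<ge> 2" "b \<ge> 2"
  proof -
    have "a \<noteq> 0" "b \<noteq> 0" "b \<noteq> 1"
      using a(3) b assms(1) by (auto intro!: Nat.gr0I)
    with a(2) show "a \<ge> 2" "b \<ge> 2" by linarith+
  qed
  show ?thesis
  proof (cases "b \<ge> 3")
    case True
    with that b \<open>a \<ge> 2\<close> show ?thesis by blast
  next
    case False
    then have "b = 2" using \<open>b \<ge> 2\<close> by simp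
    with b assms(1) have "a \<ge> 3" by simp
    with that[of b a] b \<open>b \<ge> 2\<close> show ?thesis by (simp add: mult.commute)
  qed
qed

lemma lin_dep_log_sines_rat:
  assumes q: "q = d * m" and d: "d \<ge> 2" and m: "m \<ge> 3"
  shows "lin_dep_over \<rat> (log_sines q)"
proof -
  define L where "L j = ln (2 * sin (real j * pi / real q))" for j
  \<comment> \<open>The folded index: the reflection \<open>j\<close> to \<open>q - j\<close>
    preserves the sine.\<close>
  define g where "g k = min (1 + k * m) (q - (1 + k * m))" for k
  define A where "A = {a. 1 \<le> a \<and> 2 * a < q}"
  \<comment> \<open>The number of times that index \<open>a\<close> occurs on the left of the
    relation, minus its occurrence on the right.\<close>
  define c where "c a = (\<Sum>k<d. of_bool (g k = a)) - (of_bool (d = a) :: complex)" for a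
  have "finite A"
    by (rule finite_subset[of _ "{..q}"]) (auto simp: A_def)
  have q0: "q > 0" and dA: "d \<in> A"
    using q d m by (auto simp: A_def)
  have lt: "1 + k * m < q" if "k < d" for k
  proof -
    have "(k + 1) * m \<le> d * m"
      using that by (intro mult_right_mono) auto
    then show ?thesis using q m by simp
  qed
  have gA: "g k \<in> A" if "k < d" for k
  proof -
    have "2 * (1 + k * m) \<noteq> q"
    proof
      assume "2 * (1 + k * m) = q"
      then have "2 + (2 * k) * m = d * m"
        using q by simp
      then have "m dvd 2"
        by (metis dvd_add_left_iff dvd_triv_right)
      with m show False
        by (auto dest: dvd_imp_le)
    qed
    with lt[OF that] show ?thesis
      by (auto simp: A_def g_def min_def)
  qed
  have sin_pos: "sin (real j * pi / real q) > 0" if "0 < j" "j < q" for j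
    using that by (intro sin_gt_zero) (auto simp: field_simps)
  have sin_pos': "sin (real (1 + k * m) * pi / real q) > 0" if "k < d" for k
    by (rule sin_pos) (use lt[OF that] in auto)
  have L_reflect: "L (q - j) = L j" if "j < q" for j
  proof -
    have "real (q - j) * pi / real q = pi - real j * pi / real q"
      using that by (simp add: of_nat_diff field_simps)
    then show ?thesis
      by (simp add: L_def)
  qed
  have Lg: "L (g k) = L (1 + k * m)" if "k < d" for k
    using L_reflect[OF lt[OF that]] by (simp add: g_def min_def)
  have "(\<Sum>k<d. L (1 + k * m)) = ln (\<Prod>k<d. 2 * sin (real (1 + k * m) * pi / real q))"
    unfolding L_def by (rule ln_prod[symmetric]) (auto dest: sin_pos')
  also have "(\<Prod>k<d. 2 * sin (real (1 + k * m) * pi / real q))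
      = (\<Prod>k<d. 2 * \<bar>sin (pi / real q + real k * pi / real d)\<bar>)"
  proof (intro prod.cong refl)
    fix k assume "k \<in> {..<d}"
    then have pos: "sin (real (1 + k * m) * pi / real q) > 0"
      using sin_pos' by simp
    have "real (1 + k * m) * pi / real q = pi / real q + real k * pi / real d"
      using d m by (simp add: q field_simps)
    with pos show "2 * sin (real (1 + k * m) * pi / real q)
        = 2 * \<bar>sin (pi / real q + real k * pi / real d)\<bar>"
      by simp
  qed
  also have "\<dots> = 2 * \<bar>sin (real d * (pi / real q))\<bar>"
    using d by (intro prod_abs_sin) auto
  also have "\<dots> = 2 * sin (real d * pi / real q)"
    using sin_pos[of d] dA d by (simp add: A_def)
  also have "ln \<dots> = L d"
    by (simp only: L_def)
  finally have rel: "(\<Sum>k<d. L (g k)) = L d"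
    by (simp add: Lg)
  have "(\<Sum>a\<in>A. c a * complex_of_real (L a))
      = (\<Sum>k<d. \<Sum>a\<in>A. of_bool (g k = a) * complex_of_real (L a))
        - (\<Sum>a\<in>A. of_bool (d = a) * complex_of_real (L a))"
    \<comment> \<open>After exchanging the sums, each indicator selects a single logarithm.\<close>
    unfolding c_def left_diff_distrib sum_subtractf sum_distrib_right
    by (subst sum.swap) (rule refl)
  also have "\<dots> = (\<Sum>k<d. complex_of_real (L (g k))) - complex_of_real (L d)"
    using gA dA \<open>finite A\<close> by (simp add: of_bool_def if_distrib[of "\<lambda>x. x * _"] cong: if_cong)
  also have "\<dots> = 0"
    by (simp flip: rel)
  finally have "(\<Sum>a\<in>A. c a * complex_of_real (L a)) = 0" .
  moreover have "c 1 \<noteq> 0"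
  proof -
    have "g 0 = 1"
      using q d m lt[of 0] gA[of 0] by (auto simp: g_def A_def min_def)
    \<comment> \<open>Positivity is shown for the count in the naturals and then cast to the complex
      numbers; the subtracted term of \<open>c 1\<close> vanishes because \<open>d\<close> is not
      1.\<close>
    then have "0 < (\<Sum>k<d. of_bool (g k = 1) :: nat)"
      using d by (intro sum_pos2[of _ 0]) auto
    moreover have "c 1 = of_nat (\<Sum>k<d. of_bool (g k = 1))"
      using d by (simp add: c_def)
    ultimately show ?thesis
      by (simp only: of_nat_eq_0_iff)
  qed
  moreover have "c a \<in> \<rat>" for a
  proof -
    have "c a = of_int (\<Sum>k<d. of_bool (g k = a)) - of_int (of_bool (d = a))"
      by (simp add: c_def)
    then show ?thesis
      by (metis Rats_diff Rats_of_int)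
  qed
  ultimately show ?thesis
    using q0 dA d by (intro lin_dep_over_log_sines[of c _ 1]) (auto simp: A_def L_def)
qed

lemma Rats_subset_algebraic_numbers: "\<rat> \<subseteq> algebraic_numbers"
  unfolding algebraic_numbers_def by (auto intro: rat_imp_algebraic)

theorem theorem1p3:
  fixes q :: nat
  assumes "q \<ge> 4" and "\<not> prime q"
  shows "(odd q \<longrightarrow> lin_dep_over algebraic_numbers (log_sines q @ [complex_of_real pi])) \<and>
         (even q \<longrightarrow> lin_dep_over algebraic_numbers (log_sines q @ [complex_of_real pi, Ln 2])) \<and>
         (q \<ge> 6 \<longrightarrow> lin_dep_over \<rat> (log_sines q))"
proof (cases "q \<ge> 6")
  case True
  from True assms(2) obtain d m where "q = d * m" "d \<ge> 2" "m \<ge> 3"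
    by (rule composite_factorization)
  then have rat: "lin_dep_over \<rat> (log_sines q)"
    by (rule lin_dep_log_sines_rat)
  have "0 \<in> algebraic_numbers"
    using Rats_subset_algebraic_numbers by auto
  with rat show ?thesis
    using lin_dep_over_append lin_dep_over_mono Rats_subset_algebraic_numbers by blast
next
  case False
  have "prime (5 :: nat)" by simp
  with False assms have q: "q = 4"
    by (cases "q = 5") auto
  have "2 * sin (pi / 4) = sqrt 2"
    by (simp add: sin_45)
  then have "Ln (complex_of_real (2 * sin (pi / 4))) = complex_of_real (ln 2) / 2"
    by (simp only:) (simp add: Ln_of_real ln_sqrt)
  then have "log_sines 4 = [complex_of_real (ln 2) / 2]"
    unfolding log_sines_def
    by (simp add: upt_rec)
  then have "lin_dep_over \<rat> (log_sines 4 @ [complex_of_real pi, Ln 2])"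
    unfolding lin_dep_over_def
    \<comment> \<open>The witness encodes
      \<open>2 * (log 2 / 2) + 0 * pi - log 2 = 0\<close>.\<close>
    by (intro exI[of _ "[2, 0, -1]"]) (simp add: lessThan_Suc numeral_eq_Suc Ln_of_real[of 2, simplified])
  with q show ?thesis
    using lin_dep_over_mono Rats_subset_algebraic_numbers by simp
qed

end
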